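(* Let $G=(V,E)$ be an undirected graph with weight vector $c\in\mathbb{Z}^V$, let $\Gamma$ be an automorphism group of $G$ respecting the node weights $c$, $L$ a sequence of leaders derived from $\Gamma$, and $S=S(L)$ the corresponding SST cuts. Let $G'=(V',E')$ arise from $G$ by applying the deletion presolving and then the addition presolving for $S$. Suppose $c_v\ne 0$ for all $v\in V$. Then every weight maximal stable set in $G'$ is weight maximal (among stable sets) in $G$ and satisfies all SST cuts in $S$.
   Context: All graphs are finite, simple and undirected. SST algorithm: initialize $\Gamma'\gets\Gamma$ and the empty sequence $L$. Repeat until $L$ contains all of $V$: (1) select (arbitrarily) $\ell\in V\setminus L$ and set $O_\ell\gets\{\gamma(\ell):\gamma\in\Gamma'\}$; (2) append $\ell$ to $L$ and replace $\Gamma'$ by its subgroup of permutations fixing every element of $L$. $S(L)=\{(\ell,f):\ell\in L,\ f\in O_\ell\setminus\{\ell\}\}$ is the set of SST cuts ($\ell$ leader, $f$ follower), where $(\ell,f)$ represents $-x_\ell+x_f\le 0$. A stable set satisfies an SST cut if its incidence vector in $\{0,1\}^V$ does, i.e. if it contains $\ell$ whenever it contains $f$. The weight of a stable set $A$ is $\sum_{v\in A}c_v$. Deletion presolving: delete from the graph all nodes $f$ for which there is $(\ell,f)\in S$ with $\{\ell,f\}$ an edge; $V'$ denotes the remaining nodes. Addition presolving (applied to the graph $(V',E[V'])$): for every $(\ell,f)\in S$ with $\ell,f\in V'$ and every neighbor $v$ of $\ell$, add the edge $\{v,f\}$ (if not already present). *)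

theory Defs
  imports
    "HOL-Library.Ramsey"
    "HOL-Library.Indicator_Function"
    "HOL-Algebra.Bij"
begin

section \<open>Weighted graphs and stable sets\<close>

definition simple_graph :: "'a set \<Rightarrow> 'a set set \<Rightarrow> bool" where
  "simple_graph V E \<longleftrightarrow> finite V \<and> E \<subseteq> [V]\<^bsup>2\<^esup>"

definition stable_set :: "'a set \<Rightarrow> 'a set set \<Rightarrow> 'a set \<Rightarrow> bool" where
  "stable_set V E A \<longleftrightarrow> A \<subseteq> V \<and> indep A E"

definition weight :: "('a \<Rightarrow> int) \<Rightarrow> 'a set \<Rightarrow> int" where
  "weight c A = (\<Sum>v\<in>A. c v)"

definition weight_maximal_stable_set ::
  "'a set \<Rightarrow> 'a set set \<Rightarrow> ('a \<Rightarrow> int) \<Rightarrow> 'a set \<Rightarrow> bool"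
where
  "weight_maximal_stable_set V E c A \<longleftrightarrow> is_arg_max (weight c) (stable_set V E) A"

section \<open>Automorphism groups\<close>

text \<open>
  ``An automorphism group'' is any subgroup of the full automorphism group.
\<close>

definition automorphism_group :: "'a set \<Rightarrow> 'a set set \<Rightarrow> ('a \<Rightarrow> 'a) set \<Rightarrow> bool" where
  "automorphism_group V E \<Gamma> \<longleftrightarrow>
     subgroup \<Gamma> (BijGroup V) \<and>
     (\<forall>\<gamma>\<in>\<Gamma>. \<forall>u\<in>V. \<forall>v\<in>V. {\<gamma> u, \<gamma> v} \<in> E \<longleftrightarrow> {u, v} \<in> E)"

definition respects_weights :: "'a set \<Rightarrow> ('a \<Rightarrow> int) \<Rightarrow> ('a \<Rightarrow> 'a) set \<Rightarrow> bool" where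
  "respects_weights V c \<Gamma> \<longleftrightarrow> (\<forall>\<gamma>\<in>\<Gamma>. \<forall>v\<in>V. c (\<gamma> v) = c v)"

section \<open>The SST algorithm\<close>

text \<open>
  \<open>sst_state V \<Gamma> L \<Gamma>' Orb\<close> holds iff the loop can reach a state with current sequence \<open>L\<close>,
  current group \<open>\<Gamma>'\<close> and recorded orbits \<open>Orb l\<close> for \<open>l \<in> set L\<close>; the values of \<open>Orb\<close> outside
  \<open>set L\<close> carry no meaning. The arbitrary choice of the next leader is the nondeterminism of \<open>step\<close>.
\<close>

inductive sst_state ::
  "'a set \<Rightarrow> ('a \<Rightarrow> 'a) set \<Rightarrow> 'a list \<Rightarrow> ('a \<Rightarrow> 'a) set \<Rightarrow> ('a \<Rightarrow> 'a set) \<Rightarrow> bool"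
  for V :: "'a set" and \<Gamma> :: "('a \<Rightarrow> 'a) set"
where
  init: "sst_state V \<Gamma> [] \<Gamma> (\<lambda>_. {})"
| step: "\<lbrakk>sst_state V \<Gamma> L \<Gamma>' Orb; l \<in> V - set L\<rbrakk> \<Longrightarrow>
    sst_state V \<Gamma> (L @ [l]) {\<gamma> \<in> \<Gamma>'. \<forall>v\<in>set (L @ [l]). \<gamma> v = v}
      (Orb(l := {\<gamma> l |\<gamma>. \<gamma> \<in> \<Gamma>'}))"

definition sst_output :: "'a set \<Rightarrow> ('a \<Rightarrow> 'a) set \<Rightarrow> 'a list \<Rightarrow> ('a \<Rightarrow> 'a set) \<Rightarrow> bool" where
  "sst_output V \<Gamma> L Orb \<longleftrightarrow> (\<exists>\<Gamma>'. sst_state V \<Gamma> L \<Gamma>' Orb) \<and> set L = V"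

definition sst_cuts :: "'a list \<Rightarrow> ('a \<Rightarrow> 'a set) \<Rightarrow> ('a \<times> 'a) set" where
  "sst_cuts L Orb = {(l, f). l \<in> set L \<and> f \<in> Orb l - {l}}"

fun satisfies_cut :: "'a set \<Rightarrow> 'a \<times> 'a \<Rightarrow> bool" where
  "satisfies_cut A (l, f) \<longleftrightarrow> - indicator A l + indicator A f \<le> (0 :: int)"

section \<open>Presolving\<close>

definition deletion_nodes :: "'a set \<Rightarrow> 'a set set \<Rightarrow> ('a \<times> 'a) set \<Rightarrow> 'a set" where
  "deletion_nodes V E S = V - {f. \<exists>l. (l, f) \<in> S \<and> {l, f} \<in> E}"

definition induced_edges :: "'a set set \<Rightarrow> 'a set \<Rightarrow> 'a set set" where
  "induced_edges E W = {e \<in> E. e \<subseteq> W}"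

text \<open>
  Neighbours of a leader are taken in the input graph \<open>(W, F)\<close> of the addition step, i.e. all edges
  are added simultaneously. After the deletion step no leader in \<open>W\<close> is adjacent to one of its
  followers in \<open>W\<close>, so \<open>v \<noteq> f\<close> below and no loops arise.
\<close>

definition addition_edges :: "'a set \<Rightarrow> 'a set set \<Rightarrow> ('a \<times> 'a) set \<Rightarrow> 'a set set" where
  "addition_edges W F S =
     F \<union> {{v, f} |v l f. (l, f) \<in> S \<and> l \<in> W \<and> f \<in> W \<and> {l, v} \<in> F}"

end

theory Submission
  imports Defs
begin

text \<open>
  Applying group elements to a weight-maximal stable set of \<open>G\<close> yields one that satisfies all cuts.
  When the leader \<open>l\<close> is processed and the current set \<open>A\<close> contains some \<open>f = \<gamma> l\<close> in the orbit
  of \<open>l\<close>, replace \<open>A\<close> by its preimage under \<open>\<gamma>\<close>, which contains \<open>l\<close>. Cuts of an earlier leader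
  survive, because \<open>\<gamma>\<close> fixes that leader and maps its recorded orbit into itself
  (\<open>ex_maximal_satisfying_cuts\<close>).

  A stable set of \<open>G\<close> that satisfies all cuts contains no deleted node and no added edge, so it is
  stable in \<open>G'\<close>. Conversely every stable set of \<open>G'\<close> is stable in \<open>G\<close>. Hence the maximal weights
  agree, and a weight-maximal stable set \<open>A\<close> of \<open>G'\<close> is weight-maximal in \<open>G\<close>.

  Suppose that this \<open>A\<close> violates a cut \<open>(l, f)\<close>, that is, \<open>f \<in> A\<close> and \<open>l \<notin> A\<close>. The leader \<open>l\<close> is
  a node of \<open>G'\<close>: had it been deleted because of a leader \<open>k\<close> adjacent to it, then a group element
  fixing \<open>k\<close> and mapping \<open>l\<close> to \<open>f\<close> would show that \<open>f\<close> had been deleted because of \<open>k\<close> as well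
  (\<open>sst_follower_of_follower\<close>). The added edges now ensure that no neighbour of \<open>l\<close> lies in \<open>A\<close>,
  so \<open>A \<union> {l}\<close> is stable in \<open>G\<close>. But \<open>c l = c f\<close> is nonzero, and nonnegative because removing \<open>f\<close>
  from \<open>A\<close> does not increase the weight; so \<open>A \<union> {l}\<close> is heavier than \<open>A\<close>, a contradiction.
\<close>

section \<open>Groups and orbits along the SST algorithm\<close>

lemma subgroup_BijGroup_bij:
  assumes "subgroup \<Gamma> (BijGroup V)" "\<gamma> \<in> \<Gamma>"
  shows "bij_betw \<gamma> V V"
  using subgroup.mem_carrier[OF assms] by (simp add: BijGroup_def Bij_def)

lemma subgroup_BijGroup_compose:
  assumes "subgroup \<Gamma> (BijGroup V)" "\<gamma> \<in> \<Gamma>" "\<delta> \<in> \<Gamma>"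
  shows "compose V \<gamma> \<delta> \<in> \<Gamma>"
  using subgroup.m_closed[OF assms] subgroup.mem_carrier[OF assms(1,2)]
    subgroup.mem_carrier[OF assms(1,3)]
  by (simp add: BijGroup_def)

lemma subgroup_BijGroup_pointwise_stabilizer:
  assumes \<Gamma>: "subgroup \<Gamma> (BijGroup V)" and "W \<subseteq> V"
  shows "subgroup {\<gamma> \<in> \<Gamma>. \<forall>v\<in>W. \<gamma> v = v} (BijGroup V)"
proof (rule group.subgroupI[OF group_BijGroup])
  show "{\<gamma> \<in> \<Gamma>. \<forall>v\<in>W. \<gamma> v = v} \<subseteq> carrier (BijGroup V)"
    using subgroup.subset[OF \<Gamma>] by blast
  have "\<one>\<^bsub>BijGroup V\<^esub> \<in> {\<gamma> \<in> \<Gamma>. \<forall>v\<in>W. \<gamma> v = v}"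
    using subgroup.one_closed[OF \<Gamma>] \<open>W \<subseteq> V\<close> by (auto simp: BijGroup_def)
  then show "{\<gamma> \<in> \<Gamma>. \<forall>v\<in>W. \<gamma> v = v} \<noteq> {}" by blast
next
  fix \<gamma> assume \<gamma>: "\<gamma> \<in> {\<gamma> \<in> \<Gamma>. \<forall>v\<in>W. \<gamma> v = v}"
  then have "\<gamma> \<in> Bij V" and inj: "inj_on \<gamma> V"
    using subgroup.mem_carrier[OF \<Gamma>] by (auto simp: BijGroup_def Bij_def bij_betw_def)
  moreover have "inv_into V \<gamma> v = v" if "v \<in> W" for v
    using inv_into_f_f[OF inj, of v] \<gamma> that \<open>W \<subseteq> V\<close> by auto
  ultimately show "inv\<^bsub>BijGroup V\<^esub> \<gamma> \<in> {\<gamma> \<in> \<Gamma>. \<forall>v\<in>W. \<gamma> v = v}"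
    using subgroup.m_inv_closed[OF \<Gamma>, of \<gamma>] \<gamma> \<open>W \<subseteq> V\<close> by (auto simp: inv_BijGroup)
next
  fix \<gamma> \<delta> assume "\<gamma> \<in> {\<gamma> \<in> \<Gamma>. \<forall>v\<in>W. \<gamma> v = v}" "\<delta> \<in> {\<gamma> \<in> \<Gamma>. \<forall>v\<in>W. \<gamma> v = v}"
  then show "\<gamma> \<otimes>\<^bsub>BijGroup V\<^esub> \<delta> \<in> {\<gamma> \<in> \<Gamma>. \<forall>v\<in>W. \<gamma> v = v}"
    using subgroup.m_closed[OF \<Gamma>, of \<gamma> \<delta>] subgroup.mem_carrier[OF \<Gamma>] \<open>W \<subseteq> V\<close>
    by (auto simp: BijGroup_def compose_def)
qed

lemma sst_state_group:
  assumes "sst_state V \<Gamma> L \<Gamma>' Orb" and "subgroup \<Gamma> (BijGroup V)"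
  shows "subgroup \<Gamma>' (BijGroup V) \<and> \<Gamma>' \<subseteq> \<Gamma> \<and> set L \<subseteq> V \<and> (\<forall>\<gamma>\<in>\<Gamma>'. \<forall>v\<in>set L. \<gamma> v = v)"
  using assms
proof induction
  case init
  then show ?case by simp
next
  case (step L \<Gamma>' Orb l)
  then have "subgroup \<Gamma>' (BijGroup V)" and "\<Gamma>' \<subseteq> \<Gamma>" and sub: "set (L @ [l]) \<subseteq> V" by auto
  then show ?case
    using subgroup_BijGroup_pointwise_stabilizer[OF _ sub] by blast
qed

lemma sst_state_orbits:
  assumes "sst_state V \<Gamma> L \<Gamma>' Orb" and "subgroup \<Gamma> (BijGroup V)"
  shows "\<forall>l\<in>set L. Orb l \<subseteq> V \<and> (\<forall>f\<in>Orb l. \<exists>\<gamma>\<in>\<Gamma>. f = \<gamma> l) \<and> (\<forall>\<gamma>\<in>\<Gamma>'. \<gamma> ` Orb l \<subseteq> Orb l)"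
  using assms
proof induction
  case init
  then show ?case by simp
next
  case (step L \<Gamma>' Orb m)
  let ?O = "{\<gamma> m |\<gamma>. \<gamma> \<in> \<Gamma>'}"
  have \<Gamma>': "subgroup \<Gamma>' (BijGroup V)" and "\<Gamma>' \<subseteq> \<Gamma>"
    using sst_state_group[OF step.hyps(1) step.prems] by auto
  have "m \<in> V" using step.hyps by simp
  have "\<gamma> m \<in> V" if "\<gamma> \<in> \<Gamma>'" for \<gamma>
    using subgroup_BijGroup_bij[OF \<Gamma>' that] \<open>m \<in> V\<close> by (auto simp: bij_betw_def)
  moreover have "\<exists>\<beta>. \<gamma> (\<delta> m) = \<beta> m \<and> \<beta> \<in> \<Gamma>'" if "\<gamma> \<in> \<Gamma>'" "\<delta> \<in> \<Gamma>'" for \<gamma> \<delta>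
    using subgroup_BijGroup_compose[OF \<Gamma>' that] \<open>m \<in> V\<close>
    by (intro exI[of _ "compose V \<gamma> \<delta>"]) (simp add: compose_def)
  ultimately have new: "?O \<subseteq> V \<and> (\<forall>f\<in>?O. \<exists>\<gamma>\<in>\<Gamma>. f = \<gamma> m) \<and> (\<forall>\<gamma>\<in>\<Gamma>'. \<gamma> ` ?O \<subseteq> ?O)"
    using \<open>\<Gamma>' \<subseteq> \<Gamma>\<close> by blast
  show ?case
  proof
    fix l assume "l \<in> set (L @ [m])"
    then show "(Orb(m := ?O)) l \<subseteq> V \<and> (\<forall>f\<in>(Orb(m := ?O)) l. \<exists>\<gamma>\<in>\<Gamma>. f = \<gamma> l) \<and>
        (\<forall>\<gamma>\<in>{\<gamma> \<in> \<Gamma>'. \<forall>v\<in>set (L @ [m]). \<gamma> v = v}. \<gamma> ` (Orb(m := ?O)) l \<subseteq> (Orb(m := ?O)) l)"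
      using new step.IH[OF step.prems] by (cases "l = m") simp_all
  qed
qed

text \<open>
  If \<open>l\<close> is a follower of \<open>k\<close>, then \<open>k\<close> was chosen before \<open>l\<close>, so the group defining the orbit of
  \<open>l\<close> fixes \<open>k\<close>.
\<close>

lemma sst_follower_of_follower:
  assumes "sst_state V \<Gamma> L \<Gamma>' Orb" and "subgroup \<Gamma> (BijGroup V)"
  shows "\<forall>k\<in>set L. \<forall>l\<in>set L. \<forall>f. l \<in> Orb k \<longrightarrow> l \<noteq> k \<longrightarrow> f \<in> Orb l \<longrightarrow>
           f \<in> Orb k \<and> (\<exists>\<gamma>\<in>\<Gamma>. \<gamma> k = k \<and> \<gamma> l = f)"
  using assms
proof induction
  case init
  then show ?case by simp
next
  case (step L \<Gamma>' Orb m)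
  have "\<Gamma>' \<subseteq> \<Gamma>" and fixed: "\<And>\<gamma> v. \<gamma> \<in> \<Gamma>' \<Longrightarrow> v \<in> set L \<Longrightarrow> \<gamma> v = v"
    using sst_state_group[OF step.hyps(1) step.prems] by auto
  have invariant: "\<And>\<gamma> k v. k \<in> set L \<Longrightarrow> \<gamma> \<in> \<Gamma>' \<Longrightarrow> v \<in> Orb k \<Longrightarrow> \<gamma> v \<in> Orb k"
    using sst_state_orbits[OF step.hyps(1) step.prems] by blast
  have inj: "inj_on \<gamma> V" if "\<gamma> \<in> \<Gamma>'" for \<gamma>
    using subgroup_BijGroup_bij[OF step.prems] that \<open>\<Gamma>' \<subseteq> \<Gamma>\<close> by (auto simp: bij_betw_def)
  have "set L \<subseteq> V" using sst_state_group[OF step.hyps(1) step.prems] by auto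
  have m: "m \<in> V" "m \<notin> set L" using step.hyps by auto
  \<comment> \<open>The elements of \<open>set L\<close> are fixed points of \<open>\<Gamma>'\<close>, hence not in the orbit of \<open>m\<close>.\<close>
  have new: "\<gamma> m \<notin> set L" if "\<gamma> \<in> \<Gamma>'" for \<gamma>
  proof
    assume "\<gamma> m \<in> set L"
    then have "\<gamma> (\<gamma> m) = \<gamma> m" "\<gamma> m \<in> V" using fixed[OF that] \<open>set L \<subseteq> V\<close> by blast+
    then have "\<gamma> m = m" using inj_onD[OF inj[OF that]] m(1) by blast
    then show False using \<open>\<gamma> m \<in> set L\<close> m(2) by simp
  qed
  show ?case
  proof (intro ballI allI impI)
    fix k l f
    let ?Orb = "Orb(m := {\<gamma> m |\<gamma>. \<gamma> \<in> \<Gamma>'})"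
    assume k: "k \<in> set (L @ [m])" and l: "l \<in> set (L @ [m])"
      and lk: "l \<in> ?Orb k" "l \<noteq> k" and f: "f \<in> ?Orb l"
    have "k \<noteq> m"
    proof
      assume "k = m"
      then obtain \<gamma> where "\<gamma> \<in> \<Gamma>'" "l = \<gamma> m" using lk(1) by (simp split: if_splits) blast
      moreover have "l \<in> set L" using l lk(2) \<open>k = m\<close> by simp
      ultimately show False using new by blast
    qed
    then have kL: "k \<in> set L" using k by simp
    show "f \<in> ?Orb k \<and> (\<exists>\<gamma>\<in>\<Gamma>. \<gamma> k = k \<and> \<gamma> l = f)"
    proof (cases "l = m")
      case True
      then have "f \<in> {\<gamma> l |\<gamma>. \<gamma> \<in> \<Gamma>'}" using f by (simp only: fun_upd_same)
      then obtain \<gamma> where "\<gamma> \<in> \<Gamma>'" "f = \<gamma> l" by blast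
      moreover have "l \<in> Orb k" using lk(1) \<open>k \<noteq> m\<close> by (simp only: fun_upd_apply if_False)
      ultimately have "f \<in> Orb k" "\<gamma> \<in> \<Gamma>" "\<gamma> k = k" "\<gamma> l = f"
        using invariant[OF kL] fixed[OF _ kL] \<open>\<Gamma>' \<subseteq> \<Gamma>\<close> by blast+
      then show ?thesis using \<open>k \<noteq> m\<close> by (simp only: fun_upd_apply if_False) blast
    next
      case False
      then have "l \<in> set L" "l \<in> Orb k" "f \<in> Orb l"
        using l lk(1) f \<open>k \<noteq> m\<close> by simp_all
      then have "f \<in> Orb k \<and> (\<exists>\<gamma>\<in>\<Gamma>. \<gamma> k = k \<and> \<gamma> l = f)"
        using step.IH[OF step.prems] kL lk(2) by blast
      then show ?thesis using \<open>k \<noteq> m\<close> by (simp only: fun_upd_apply if_False)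
    qed
  qed
qed

section \<open>Maximal stable sets satisfying all cuts\<close>

lemma satisfies_cut_iff: "satisfies_cut A (l, f) \<longleftrightarrow> (f \<in> A \<longrightarrow> l \<in> A)"
  by (auto simp: indicator_def)

lemma weight_maximal_stable_set_iff:
  "weight_maximal_stable_set V E c A \<longleftrightarrow>
     stable_set V E A \<and> (\<forall>B. stable_set V E B \<longrightarrow> weight c B \<le> weight c A)"
  by (simp add: weight_maximal_stable_set_def is_arg_max_linorder)

lemma ex_weight_maximal_stable_set:
  assumes "finite V"
  shows "\<exists>A. weight_maximal_stable_set V E c A"
proof -
  have "finite {A. stable_set V E A}"
    by (rule finite_subset[of _ "Pow V"]) (use assms in \<open>auto simp: stable_set_def\<close>)
  moreover have "{} \<in> {A. stable_set V E A}"
    by (simp add: stable_set_def)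
  ultimately obtain A where "is_arg_min (\<lambda>A. - weight c A) (\<lambda>A. A \<in> {A. stable_set V E A}) A"
    using ex_is_arg_min_if_finite[of "{A. stable_set V E A}" "\<lambda>A. - weight c A"] by blast
  then have "weight_maximal_stable_set V E c A"
    by (simp add: weight_maximal_stable_set_iff is_arg_min_linorder)
  then show ?thesis by blast
qed

text \<open>The preimage of a stable set under an automorphism is stable and has the same weight.\<close>

lemma weight_maximal_stable_set_preimage:
  assumes A: "weight_maximal_stable_set V E c A"
    and bij: "bij_betw \<gamma> V V"
    and edges: "\<And>u v. u \<in> V \<Longrightarrow> v \<in> V \<Longrightarrow> {\<gamma> u, \<gamma> v} \<in> E \<longleftrightarrow> {u, v} \<in> E"
    and weights: "\<And>v. v \<in> V \<Longrightarrow> c (\<gamma> v) = c v"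
  shows "weight_maximal_stable_set V E c {v \<in> V. \<gamma> v \<in> A}"
proof -
  let ?B = "{v \<in> V. \<gamma> v \<in> A}"
  have stab: "stable_set V E A"
    using A by (simp add: weight_maximal_stable_set_iff)
  then have "A \<subseteq> V" by (simp add: stable_set_def)
  have inj: "inj_on \<gamma> V" and surj: "\<gamma> ` V = V" using bij by (auto simp: bij_betw_def)
  have "bij_betw \<gamma> ?B A"
    unfolding bij_betw_def
  proof
    show "inj_on \<gamma> ?B" by (rule inj_on_subset[OF inj]) auto
    show "\<gamma> ` ?B = A"
    proof
      show "A \<subseteq> \<gamma> ` ?B"
      proof
        fix a assume "a \<in> A"
        then have "a \<in> \<gamma> ` V" using surj \<open>A \<subseteq> V\<close> by (simp add: subsetD)
        then show "a \<in> \<gamma> ` ?B" using \<open>a \<in> A\<close> by blast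
      qed
    qed blast
  qed
  then have "weight c A = (\<Sum>v\<in>?B. c (\<gamma> v))"
    unfolding weight_def by (rule sum.reindex_bij_betw[symmetric])
  also have "\<dots> = weight c ?B"
    unfolding weight_def by (rule sum.cong) (simp_all add: weights)
  finally have "weight c ?B = weight c A" by (rule sym)
  moreover have "stable_set V E ?B"
    unfolding stable_set_def indep_def
  proof (intro conjI ballI impI)
    fix u v assume uv: "u \<in> ?B" "v \<in> ?B" "u \<noteq> v"
    then have "\<gamma> u \<noteq> \<gamma> v" using inj by (simp add: inj_on_eq_iff)
    moreover have "u \<in> V" "v \<in> V" "\<gamma> u \<in> A" "\<gamma> v \<in> A" using uv by simp_all
    ultimately show "{u, v} \<notin> E"
      using stab edges[of u v] by (simp add: stable_set_def indep_def)
  qed blast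
  ultimately show ?thesis
    using A by (simp add: weight_maximal_stable_set_iff)
qed

lemma ex_maximal_satisfying_cuts:
  assumes "sst_state V \<Gamma> L \<Gamma>' Orb" and "finite V"
    and "automorphism_group V E \<Gamma>" and "respects_weights V c \<Gamma>"
  shows "\<exists>A. weight_maximal_stable_set V E c A \<and> (\<forall>l\<in>set L. \<forall>f\<in>Orb l. f \<in> A \<longrightarrow> l \<in> A)"
  using assms
proof induction
  case init
  then show ?case using ex_weight_maximal_stable_set by simp
next
  case (step L \<Gamma>' Orb m)
  then obtain A where A: "weight_maximal_stable_set V E c A"
    and cuts: "\<And>l f. l \<in> set L \<Longrightarrow> f \<in> Orb l \<Longrightarrow> f \<in> A \<Longrightarrow> l \<in> A"
    by blast
  have \<Gamma>: "subgroup \<Gamma> (BijGroup V)"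
    using step.prems by (simp add: automorphism_group_def)
  have m: "m \<in> V" "m \<notin> set L" using step.hyps by auto
  show ?case
  proof (cases "\<exists>\<gamma>\<in>\<Gamma>'. \<gamma> m \<in> A")
    case False
    then have "\<forall>l\<in>set (L @ [m]). \<forall>f\<in>(Orb(m := {\<gamma> m |\<gamma>. \<gamma> \<in> \<Gamma>'})) l. f \<in> A \<longrightarrow> l \<in> A"
      using cuts m by auto
    then show ?thesis using A by blast
  next
    case True
    then obtain \<gamma> where \<gamma>: "\<gamma> \<in> \<Gamma>'" "\<gamma> m \<in> A" by blast
    let ?B = "{v \<in> V. \<gamma> v \<in> A}"
    have "\<gamma> \<in> \<Gamma>" and fixed: "\<And>v. v \<in> set L \<Longrightarrow> \<gamma> v = v" and "set L \<subseteq> V"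
      using sst_state_group[OF step.hyps(1) \<Gamma>] \<gamma> by auto
    have invariant: "\<And>l f. l \<in> set L \<Longrightarrow> f \<in> Orb l \<Longrightarrow> \<gamma> f \<in> Orb l"
      using sst_state_orbits[OF step.hyps(1) \<Gamma>] \<gamma> by blast
    have "weight_maximal_stable_set V E c ?B"
      using step.prems \<open>\<gamma> \<in> \<Gamma>\<close>
      by (intro weight_maximal_stable_set_preimage[OF A subgroup_BijGroup_bij[OF \<Gamma>]])
        (auto simp: automorphism_group_def respects_weights_def)
    moreover have "l \<in> ?B" if "l \<in> set L" "f \<in> Orb l" "f \<in> ?B" for l f
      using cuts[OF that(1) invariant[OF that(1,2)]] fixed[OF that(1)] that \<open>set L \<subseteq> V\<close> by auto
    moreover have "m \<in> ?B" using m \<gamma> by simp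
    ultimately have "\<forall>l\<in>set (L @ [m]). \<forall>f\<in>(Orb(m := {\<gamma> m |\<gamma>. \<gamma> \<in> \<Gamma>'})) l. f \<in> ?B \<longrightarrow> l \<in> ?B"
      using m by auto
    then show ?thesis using \<open>weight_maximal_stable_set V E c ?B\<close> by blast
  qed
qed

section \<open>Presolving\<close>

lemma stable_set_presolved_if_satisfies_cuts:
  assumes "simple_graph V E" and stab: "stable_set V E A"
    and cuts: "\<And>l f. (l, f) \<in> S \<Longrightarrow> l \<noteq> f \<and> (f \<in> A \<longrightarrow> l \<in> A)"
    and V': "V' = deletion_nodes V E S"
    and E': "E' = addition_edges V' (induced_edges E V') S"
  shows "stable_set V' E' A"
proof -
  have no_edge: "{u, v} \<notin> E" if "u \<in> A" "v \<in> A" for u v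
  proof (cases "u = v")
    case True
    then show ?thesis using assms(1) by (auto simp: simple_graph_def nsets_def)
  next
    case False
    then show ?thesis using stab that by (auto simp: stable_set_def indep_def)
  qed
  have "A \<subseteq> V'"
    using stab no_edge cuts unfolding V' deletion_nodes_def stable_set_def by blast
  moreover have "{u, v} \<notin> E'" if uv: "u \<in> A" "v \<in> A" for u v
  proof
    assume "{u, v} \<in> E'"
    then obtain w l f where "(l, f) \<in> S" "{l, w} \<in> E" "{u, v} = {w, f}"
      using no_edge[OF uv] unfolding E' addition_edges_def induced_edges_def by blast
    then have "w \<in> A" "f \<in> A" using uv by (auto simp: doubleton_eq_iff)
    then show False using cuts \<open>(l, f) \<in> S\<close> \<open>{l, w} \<in> E\<close> no_edge by blast
  qed
  ultimately show ?thesis by (auto simp: stable_set_def indep_def)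
qed

lemma stable_set_if_presolved:
  assumes "stable_set V' E' A"
    and "V' = deletion_nodes V E S"
    and "E' = addition_edges V' (induced_edges E V') S"
  shows "stable_set V E A"
proof -
  have "A \<subseteq> V'" "V' \<subseteq> V" using assms by (auto simp: stable_set_def deletion_nodes_def)
  moreover have "{u, v} \<in> E'" if "u \<in> A" "v \<in> A" "{u, v} \<in> E" for u v
    using that \<open>A \<subseteq> V'\<close> unfolding assms(3) addition_edges_def induced_edges_def by auto
  ultimately show ?thesis
    using assms(1) unfolding stable_set_def indep_def by blast
qed

section \<open>Maximal stable sets of the presolved graph\<close>

theorem proposition4p5:
  fixes V :: "'a set" and E :: "'a set set" and c :: "'a \<Rightarrow> int"
    and \<Gamma> :: "('a \<Rightarrow> 'a) set" and L :: "'a list" and Orb :: "'a \<Rightarrow> 'a set"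
    and S :: "('a \<times> 'a) set" and V' :: "'a set" and E' :: "'a set set"
  assumes "simple_graph V E"
    and "automorphism_group V E \<Gamma>"
    and "respects_weights V c \<Gamma>"
    and "sst_output V \<Gamma> L Orb"
    and "S = sst_cuts L Orb"
    and "V' = deletion_nodes V E S"
    and "E' = addition_edges V' (induced_edges E V') S"
    and "\<forall>v\<in>V. c v \<noteq> 0"
  shows "\<forall>A. weight_maximal_stable_set V' E' c A \<longrightarrow>
           weight_maximal_stable_set V E c A \<and> (\<forall>cut\<in>S. satisfies_cut A cut)"
proof (intro allI impI)
  fix A assume A: "weight_maximal_stable_set V' E' c A"
  have "finite V" using assms(1) by (simp add: simple_graph_def)
  have \<Gamma>: "subgroup \<Gamma> (BijGroup V)"
    and edges: "\<And>\<gamma> u v. \<gamma> \<in> \<Gamma> \<Longrightarrow> u \<in> V \<Longrightarrow> v \<in> V \<Longrightarrow> {\<gamma> u, \<gamma> v} \<in> E \<longleftrightarrow> {u, v} \<in> E"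
    using assms(2) by (auto simp: automorphism_group_def)
  obtain \<Gamma>' where state: "sst_state V \<Gamma> L \<Gamma>' Orb" and "set L = V"
    using assms(4) by (auto simp: sst_output_def)
  have S_iff: "(l, f) \<in> S \<longleftrightarrow> l \<in> V \<and> f \<in> Orb l \<and> f \<noteq> l" for l f
    using assms(5) \<open>set L = V\<close> by (simp add: sst_cuts_def)
  have stab': "stable_set V' E' A"
    using A by (simp add: weight_maximal_stable_set_iff)
  have stab: "stable_set V E A"
    by (rule stable_set_if_presolved[OF stab' assms(6,7)])
  then have "A \<subseteq> V" "finite A"
    using \<open>finite V\<close> by (auto simp: stable_set_def intro: finite_subset)
  have "A \<subseteq> V'" using stab' by (simp add: stable_set_def)

  obtain B where B: "weight_maximal_stable_set V E c B"
    and B_cuts: "\<forall>l\<in>set L. \<forall>f\<in>Orb l. f \<in> B \<longrightarrow> l \<in> B"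
    using ex_maximal_satisfying_cuts[OF state \<open>finite V\<close> assms(2,3)] by blast
  have "stable_set V' E' B"
  proof (rule stable_set_presolved_if_satisfies_cuts[OF assms(1) _ _ assms(6,7)])
    show "stable_set V E B" using B by (simp add: weight_maximal_stable_set_iff)
    show "l \<noteq> f \<and> (f \<in> B \<longrightarrow> l \<in> B)" if "(l, f) \<in> S" for l f
      using that B_cuts \<open>set L = V\<close> by (auto simp: S_iff)
  qed
  then have "weight c B \<le> weight c A"
    using A by (auto simp: weight_maximal_stable_set_iff)
  then have A_max: "weight c C \<le> weight c A" if "stable_set V E C" for C
    using B that by (fastforce simp: weight_maximal_stable_set_iff)
  then have "weight_maximal_stable_set V E c A"
    using stab by (auto simp: weight_maximal_stable_set_iff)
  moreover have "l \<in> A" if lf: "(l, f) \<in> S" and "f \<in> A" for l f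
  proof (rule ccontr)
    assume "l \<notin> A"
    have "l \<in> V" "f \<in> Orb l" using lf S_iff by auto
    have "f \<in> V'" using \<open>f \<in> A\<close> \<open>A \<subseteq> V'\<close> by blast
    have "l \<in> V'"
    proof (rule ccontr)
      assume "l \<notin> V'"
      then obtain k where k: "(k, l) \<in> S" "{k, l} \<in> E"
        using \<open>l \<in> V\<close> unfolding assms(6) deletion_nodes_def by blast
      then have "k \<in> V" "l \<in> Orb k" "l \<noteq> k" using S_iff by auto
      then obtain \<gamma> where \<gamma>: "f \<in> Orb k" "\<gamma> \<in> \<Gamma>" "\<gamma> k = k" "\<gamma> l = f"
        using sst_follower_of_follower[OF state \<Gamma>] \<open>set L = V\<close> \<open>l \<in> V\<close> \<open>f \<in> Orb l\<close> by blast
      have "{k, f} \<in> E" using edges[of \<gamma> k l] \<gamma> k \<open>k \<in> V\<close> \<open>l \<in> V\<close> by simp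
      then have "f \<noteq> k" using assms(1) by (auto simp: simple_graph_def nsets_def)
      then have "(k, f) \<in> S" using \<gamma> \<open>k \<in> V\<close> S_iff by simp
      then show False
        using \<open>{k, f} \<in> E\<close> \<open>f \<in> V'\<close> unfolding assms(6) deletion_nodes_def by blast
    qed
    have "{l, v} \<notin> E" if "v \<in> A" for v
    proof
      assume lv: "{l, v} \<in> E"
      then have "{v, f} \<in> E'"
        using lf \<open>l \<in> V'\<close> \<open>f \<in> V'\<close> \<open>v \<in> A\<close> \<open>A \<subseteq> V'\<close>
        unfolding assms(7) addition_edges_def induced_edges_def by blast
      moreover have "v \<noteq> f"
        using lv lf \<open>f \<in> V'\<close> unfolding assms(6) deletion_nodes_def by blast
      ultimately show False
        using stab' \<open>v \<in> A\<close> \<open>f \<in> A\<close> by (auto simp: stable_set_def indep_def)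
    qed
    then have "stable_set V E (insert l A)"
      using stab \<open>l \<in> V\<close> by (auto simp: stable_set_def indep_def insert_commute)
    then have "c l \<le> 0"
      using A_max[of "insert l A"] \<open>l \<notin> A\<close> \<open>finite A\<close> by (simp add: weight_def)
    have "stable_set V E (A - {f})" using stab by (auto simp: stable_set_def indep_def)
    then have "0 \<le> c f"
      using A_max[of "A - {f}"] \<open>f \<in> A\<close> \<open>finite A\<close> by (simp add: weight_def sum_diff1)
    obtain \<gamma> where "\<gamma> \<in> \<Gamma>" "f = \<gamma> l"
      using sst_state_orbits[OF state \<Gamma>] \<open>set L = V\<close> \<open>l \<in> V\<close> \<open>f \<in> Orb l\<close> by blast
    then have "c f = c l" using assms(3) \<open>l \<in> V\<close> by (simp add: respects_weights_def)
    then show False using \<open>c l \<le> 0\<close> \<open>0 \<le> c f\<close> assms(8) \<open>l \<in> V\<close> by force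
  qed
  then have "\<forall>cut\<in>S. satisfies_cut A cut"
    by (auto simp del: satisfies_cut.simps simp: satisfies_cut_iff)
  ultimately show
    "weight_maximal_stable_set V E c A \<and> (\<forall>cut\<in>S. satisfies_cut A cut)" by blast
qed

end
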